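(* Let $f$ and $g$ be arithmetical functions that admit absolutely convergent Ramanujan expansions $$f(n)=\sum_{r\ge 1}\hat f(r)\,c_r(n),\qquad g(n)=\sum_{s\ge 1}\hat g(s)\,c_s(n)\qquad (n\ge 1),$$ for some complex coefficients $\hat f(r),\hat g(s)$. Suppose there is $\delta>1/2$ such that $|\hat f(r)|\ll r^{-(1+\delta)}$ and $|\hat g(r)|\ll r^{-(1+\delta)}$ for all $r\ge 1$. Then, as $N\to\infty$, $$\sum_{n\le N} f(n)g(n)=N\sum_{r\ge 1}\hat f(r)\hat g(r)\phi(r)+O\!\left(N^{\frac{2}{1+2\delta}}(\log N)^{\frac{5+2\delta}{1+2\delta}}\right).$$
   Context: For positive integers $r,n$, the Ramanujan sum is $c_r(n)=\sum_{a\in(\mathbb Z/r\mathbb Z)^*}\zeta_r^{an}$, where $\zeta_r$ is a primitive $r$-th root of unity; equivalently $c_r(n)=\sum_{d\mid \gcd(n,r)}\mu(r/d)\,d$. A Ramanujan expansion of $f$ is a representation $f(n)=\sum_r \hat f(r)c_r(n)$; it is absolutely convergent if the series converges absolutely for every $n$. $\phi$ is Euler's totient function. Implied constants may depend on $f,g,\delta$. *)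

theory Defs
  imports
    "HOL-Analysis.Analysis"
    "HOL-Library.Landau_Symbols"
    "HOL-Number_Theory.Totient"
begin

text \<open>
  The set \<open>totatives r\<close>, the integers in \<open>{1..r}\<close> coprime to \<open>r\<close>, represents
  the unit group of the integers modulo \<open>r\<close>, and the primitive \<open>r\<close>-th root of
  unity is \<open>cis (2 * pi / r)\<close>.
\<close>

definition ramanujan_sum :: "nat \<Rightarrow> nat \<Rightarrow> complex" where
  "ramanujan_sum r n = (\<Sum>a\<in>totatives r. cis (2 * pi / real r) ^ (a * n))"

text \<open>
  An arithmetical function is a function on the positive integers, so the value at \<open>0\<close>
  is never constrained; likewise for the coefficients.
\<close>

definition abs_conv_ramanujan_expansion :: "(nat \<Rightarrow> complex) \<Rightarrow> (nat \<Rightarrow> complex) \<Rightarrow> bool" where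
  "abs_conv_ramanujan_expansion f fhat \<longleftrightarrow>
     (\<forall>n\<ge>1. (\<lambda>r. norm (fhat r * ramanujan_sum r n)) summable_on {1..} \<and>
            ((\<lambda>r. fhat r * ramanujan_sum r n) has_sum f n) {1..})"

end

theory Submission
  imports Defs "HOL-Computational_Algebra.Squarefree"
begin

text \<open>
  Write \<open>E(r, s)\<close> for the sum of \<open>c_r(n) c_s(n)\<close> over \<open>n \<le> N\<close> minus its expected value, which is
  \<open>N \<phi>(r)\<close> if \<open>r = s\<close> and \<open>0\<close> otherwise. Expanding both Ramanujan sums over divisors and using
  \<open>gcd d e = (\<Sum>k | k dvd gcd d e. \<phi> k)\<close> for the main term, one finds that \<open>E(r, s)\<close> is the sum over
  \<open>d dvd r\<close>, \<open>e dvd s\<close> of \<open>\<mu>(r/d) \<mu>(s/e) d e\<close> times the rounding error of \<open>x = N / lcm d e\<close>.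
  This rounding error is at most \<open>min 1 x \<le> x\<^sup>t\<close> for every \<open>t\<close> in \<open>[0, 1]\<close>, and \<open>lcm d e \<ge> sqrt (d e)\<close>,
  so that \<open>|E(r, s)| \<le> N\<^sup>t S(r) S(s)\<close> with \<open>S(r) = (\<Sum>d | d dvd r. d powr (1 - t/2))\<close>.

  For \<open>t = 2 / (1 + 2 \<delta>)\<close> the condition \<open>\<delta> > 1/2\<close> is equivalent to \<open>\<delta> + t/2 > 1\<close>, which makes the series
  of \<open>r powr (-(1 + \<delta>)) S(r)\<close> converge. Summing over all \<open>r\<close> and \<open>s\<close>, with no truncation, yields the
  error term \<open>O(N\<^sup>t)\<close>, which is stronger than the claim by the power of \<open>log N\<close>.
\<close>

section \<open>Divisor sums of the Moebius function\<close>

definition moebius_mu :: "nat \<Rightarrow> complex" where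
  "moebius_mu n = (if squarefree n then (-1) ^ card (prime_factors n) else 0)"

lemma norm_moebius_mu_le: "norm (moebius_mu n) \<le> 1"
  by (simp add: moebius_mu_def norm_power)

text \<open>A new prime leaves squarefreeness unchanged and adds exactly one prime factor. This is
  the sign flip behind the cancellation in the next lemma.\<close>

lemma moebius_mu_prime_mult:
  assumes "prime p" and "\<not> p dvd n"
  shows "moebius_mu (p * n) = - moebius_mu n"
proof -
  have "n > 0" using assms(2) by (cases "n = 0") auto
  have cop: "coprime p n" using assms by (simp add: prime_imp_coprime)
  have sqf: "squarefree (p * n) \<longleftrightarrow> squarefree n"
    using squarefree_mult_coprime[OF cop squarefree_prime[OF \<open>prime p\<close>]] squarefree_multD(2) by blast
  have "prime_factors (p * n) = insert p (prime_factors n)"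
    using \<open>n > 0\<close> assms(1) by (simp add: prime_factors_product prime_prime_factors prime_gt_0_nat)
  moreover have "p \<notin> prime_factors n" using assms(2) by auto
  ultimately show ?thesis by (simp add: moebius_mu_def sqf)
qed

text \<open>Only squarefree divisors count. For \<open>n > 1\<close> and a prime \<open>p\<close>
  dividing \<open>n\<close>, the map \<open>d\<close> to \<open>p * d\<close> pairs those not
  divisible by \<open>p\<close> with those divisible by \<open>p\<close>, and each pair
  cancels.\<close>

lemma sum_moebius_mu_divisors:
  assumes "n > 0"
  shows "(\<Sum>d | d dvd n. moebius_mu d) = (if n = 1 then 1 else 0)"
proof (cases "n = 1")
  case True
  then show ?thesis by (simp add: moebius_mu_def)
next
  case False
  then obtain p where p: "prime p" "p dvd n" using prime_factor_nat by blast
  have fin: "finite {d. d dvd n}" using assms by simp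
  define A where "A = {d. d dvd n \<and> squarefree d \<and> \<not> p dvd d}"
  define B where "B = {d. d dvd n \<and> squarefree d \<and> p dvd d}"
  have "(\<Sum>d | d dvd n. moebius_mu d) = (\<Sum>d \<in> A \<union> B. moebius_mu d)"
    by (rule sum.mono_neutral_right) (use fin in \<open>auto simp: A_def B_def moebius_mu_def\<close>)
  also have "\<dots> = (\<Sum>d\<in>A. moebius_mu d) + (\<Sum>d\<in>B. moebius_mu d)"
    by (rule sum.union_disjoint) (use fin in \<open>auto simp: A_def B_def\<close>)
  also have "(\<Sum>d\<in>B. moebius_mu d) = (\<Sum>d\<in>A. moebius_mu (p * d))"
  proof (rule sum.reindex_bij_witness[of _ "\<lambda>d. p * d" "\<lambda>d. d div p"])
    fix d assume d: "d \<in> B"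
    then show "p * (d div p) = d" by (simp add: B_def)
    then show "moebius_mu (p * (d div p)) = moebius_mu d" by simp
    obtain e where e: "d = p * e" using d by (auto simp: B_def elim: dvdE)
    \<comment> \<open>A squarefree \<open>d\<close> contains \<open>p\<close> only once, so division
      by \<open>p\<close> really lands in \<open>A\<close>.\<close>
    have "\<not> p dvd e"
    proof
      assume "p dvd e"
      then have "p ^ 2 dvd d" by (simp add: e power2_eq_square)
      then show False using squarefreeD[of d p] d p(1) by (simp add: B_def)
    qed
    then show "d div p \<in> A" using d p(1) squarefree_multD(2)
      by (auto simp: A_def B_def e prime_gt_0_nat elim: dvd_mult_right)
  next
    fix d assume d: "d \<in> A"
    show "p * d div p = d" using p(1) by (simp add: prime_gt_0_nat)
    have cop: "coprime p d" using d p(1) by (simp add: A_def prime_imp_coprime)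
    then show "p * d \<in> B" using d p squarefree_mult_coprime[OF cop] squarefree_prime
      by (auto simp: A_def B_def intro: divides_mult)
  qed
  also have "\<dots> = - (\<Sum>d\<in>A. moebius_mu d)"
    unfolding sum_negf[symmetric]
    by (intro sum.cong refl moebius_mu_prime_mult) (use p in \<open>auto simp: A_def\<close>)
  finally show ?thesis using False by simp
qed

text \<open>If \<open>r = k * m\<close>, the substitution \<open>e = r div d\<close> turns the sum
  into a full divisor sum of \<open>moebius_mu\<close> over \<open>m\<close>, which survives only
  for \<open>m = 1\<close>.\<close>

lemma sum_moebius_mu_codivisors:
  assumes "r > 0"
  shows "(\<Sum>d | d dvd r \<and> k dvd d. moebius_mu (r div d)) = (if k = r then 1 else 0)"
proof (cases "k dvd r")
  case False
  then have "{d. d dvd r \<and> k dvd d} = {}" by (auto dest: dvd_trans)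
  then show ?thesis using False by (auto simp: sum.empty simp del: Collect_empty_eq)
next
  case True
  then obtain m where m: "r = k * m" by (elim dvdE)
  have pos: "k > 0" "m > 0" using assms m by auto
  have "(\<Sum>d | d dvd r \<and> k dvd d. moebius_mu (r div d)) = (\<Sum>e | e dvd m. moebius_mu e)"
  proof (rule sum.reindex_bij_witness[of _ "\<lambda>e. k * (m div e)" "\<lambda>d. r div d"])
    fix d assume "d \<in> {d. d dvd r \<and> k dvd d}"
    then obtain j l where "d = k * j" "m = j * l" using pos by (auto simp: m elim!: dvdE)
    then show "r div d \<in> {e. e dvd m}" "k * (m div (r div d)) = d" 
      using pos by (auto simp: m)
  next
    fix e assume "e \<in> {e. e dvd m}"
    then obtain j where "m = e * j" by (auto elim: dvdE)
    then show "r div (k * (m div e)) = e" "k * (m div e) \<in> {d. d dvd r \<and> k dvd d}"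
      using pos by (auto simp: m)
  qed simp
  also have "\<dots> = (if k = r then 1 else 0)" using sum_moebius_mu_divisors pos by (simp add: m)
  finally show ?thesis .
qed

text \<open>Orthogonality of Ramanujan sums in arithmetic form. Once the gcd is expanded through
  totients, the term for each \<open>k\<close> factors into two codivisor sums, which force
  \<open>k = r\<close> and \<open>k = s\<close>.\<close>

lemma sum_moebius_mu_gcd:
  assumes "r > 0" and "s > 0"
  shows "(\<Sum>d | d dvd r. \<Sum>e | e dvd s. moebius_mu (r div d) * moebius_mu (s div e) * of_nat (gcd d e))
    = (if r = s then of_nat (totient r) else 0)"
proof -
  have fin: "finite {d. d dvd r}" "finite {e. e dvd s}" using assms by simp_all
  \<comment> \<open>The range of \<open>k\<close> is widened to all divisors of \<open>r\<close>, so
    that it no longer depends on \<open>d\<close> and \<open>e\<close> and the sums can be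
    swapped.\<close>
  have g: "(of_nat (gcd d e) :: complex) =
      (\<Sum>k | k dvd r. of_nat (totient k) * of_bool (k dvd d) * of_bool (k dvd e))" if "d dvd r" for d e
  proof -
    have "{k. k dvd gcd d e} = {k. k dvd r} \<inter> {k. k dvd d \<and> k dvd e}" 
      using that by (auto dest: dvd_trans)
    then have "(\<Sum>k | k dvd gcd d e. totient k)
       = (\<Sum>k | k dvd r. totient k * of_bool (k dvd d) * of_bool (k dvd e))"
      by (simp only: sum.inter_restrict[OF fin(1)]) (auto intro: sum.cong)
    then have "gcd d e = (\<Sum>k | k dvd r. totient k * of_bool (k dvd d) * of_bool (k dvd e))"
      by (simp only: totient_divisor_sum)
    then show ?thesis
      by (metis (mono_tags, lifting) of_nat_sum of_nat_mult of_nat_of_bool sum.cong)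
  qed
  have mu: "(\<Sum>d | d dvd q. moebius_mu (q div d) * of_bool (k dvd d)) = (if k = q then 1 else 0)"
    if "q > 0" for q k
  proof -
    have "(\<Sum>d | d dvd q. moebius_mu (q div d) * of_bool (k dvd d))
        = (\<Sum>d \<in> {d. d dvd q} \<inter> {d. k dvd d}. moebius_mu (q div d))"
      unfolding sum.inter_restrict[OF finite_divisors_nat[OF that]] by (intro sum.cong refl) simp
    also have "{d. d dvd q} \<inter> {d. k dvd d} = {d. d dvd q \<and> k dvd d}" by auto
    finally show ?thesis using sum_moebius_mu_codivisors[OF that] by simp
  qed
  have "(\<Sum>d | d dvd r. \<Sum>e | e dvd s. moebius_mu (r div d) * moebius_mu (s div e) * of_nat (gcd d e))
    = (\<Sum>d | d dvd r. \<Sum>e | e dvd s. \<Sum>k | k dvd r. of_nat (totient k) *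
        (moebius_mu (r div d) * of_bool (k dvd d)) * (moebius_mu (s div e) * of_bool (k dvd e)))"
    by (intro sum.cong refl) (simp add: g sum_distrib_left mult_ac)
  also have "\<dots> = (\<Sum>d | d dvd r. \<Sum>k | k dvd r. \<Sum>e | e dvd s. of_nat (totient k) *
        (moebius_mu (r div d) * of_bool (k dvd d)) * (moebius_mu (s div e) * of_bool (k dvd e)))"
    by (intro sum.cong refl sum.swap)
  also have "\<dots> = (\<Sum>k | k dvd r. \<Sum>d | d dvd r. \<Sum>e | e dvd s. of_nat (totient k) *
        (moebius_mu (r div d) * of_bool (k dvd d)) * (moebius_mu (s div e) * of_bool (k dvd e)))"
    by (rule sum.swap)
  also have "\<dots> = (\<Sum>k | k dvd r. of_nat (totient k) *
        (\<Sum>d | d dvd r. moebius_mu (r div d) * of_bool (k dvd d)) *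
        (\<Sum>e | e dvd s. moebius_mu (s div e) * of_bool (k dvd e)))"
    by (simp add: sum_distrib_left sum_distrib_right mult_ac)
  also have "\<dots> = (\<Sum>k | k dvd r. if k = r then (if r = s then of_nat (totient r) else 0) else 0)"
    by (intro sum.cong refl) (simp only: mu[OF assms(1)] mu[OF assms(2)], simp)
  also have "\<dots> = (if r = s then of_nat (totient r) else 0)"
    using fin by (simp add: sum.delta)
  finally show ?thesis .
qed

section \<open>Ramanujan sums as divisor sums\<close>

text \<open>A geometric sum in \<open>z\<close>, the \<open>n\<close>-th power of the primitive
  root: since \<open>z ^ r = 1\<close>, it vanishes unless \<open>z = 1\<close>, which means
  \<open>r dvd n\<close>.\<close>

lemma sum_root_of_unity_powers:
  assumes "r > 0"
  shows "(\<Sum>a\<in>{0<..r}. cis (2 * pi / real r) ^ (a * n)) = (if r dvd n then of_nat r else 0)"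
proof -
  define z where "z = cis (2 * pi / real r) ^ n"
  have "cis (2 * pi / real r) ^ r = 1" unfolding Complex.DeMoivre using assms by simp
  then have zr: "z ^ r = 1" unfolding z_def by (metis power_commutes power_mult mult.commute power_one)
  have "z = exp (2 * of_real pi * \<i> * of_nat n / of_nat r)"
    unfolding z_def Complex.DeMoivre unfolding cis_conv_exp by (rule arg_cong[where f = exp]) simp
  then have z1: "z = 1 \<longleftrightarrow> r dvd n"
    using complex_root_unity_eq_1[of r n] assms by simp
  have "(\<Sum>a\<in>{0<..r}. cis (2 * pi / real r) ^ (a * n)) = (\<Sum>a\<in>{0<..r}. z ^ a)"
    by (simp add: z_def mult.commute flip: power_mult)
  \<comment> \<open>Exponents from 1 to \<open>r\<close> instead of 0 to \<open>r - 1\<close> cost a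
    factor \<open>z\<close>, which is harmless: either \<open>z = 1\<close> or the sum is 0.\<close>
  also have "\<dots> = (\<Sum>a<r. z ^ Suc a)"
    by (rule sum.reindex_bij_witness[of _ Suc "\<lambda>a. a - 1"]) auto
  also have "\<dots> = z * (\<Sum>a<r. z ^ a)" by (simp add: sum_distrib_left)
  also have "\<dots> = (if r dvd n then of_nat r else 0)"
    using zr z1 by (auto simp: sum_gp_strict)
  finally show ?thesis .
qed

text \<open>The coprimality condition is detected by a Moebius sum over \<open>d\<close>. The
  multiples of \<open>d\<close> up to \<open>r\<close> then give a complete sum over roots of unity
  of order \<open>r div d\<close>.\<close>

lemma ramanujan_sum_eq_sum_divisors:
  assumes "r > 0"
  shows "ramanujan_sum r n = (\<Sum>d | d dvd r. moebius_mu (r div d) * (if d dvd n then of_nat d else 0))"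
proof -
  define w where "w = cis (2 * pi / real r)"
  have fin: "finite {d. d dvd r}" using assms by simp
  have ind: "(if coprime a r then 1 else 0) = (\<Sum>d | d dvd r. if d dvd a then moebius_mu d else 0)" for a
  proof -
    have "(if coprime a r then 1 else 0) = (\<Sum>d | d dvd gcd a r. moebius_mu d)"
      using assms by (subst sum_moebius_mu_divisors) (auto simp: coprime_iff_gcd_eq_1)
    also have "{d. d dvd gcd a r} = {d. d dvd r} \<inter> {d. d dvd a}" by auto
    finally show ?thesis using fin by (simp add: sum.inter_restrict)
  qed
  have inner: "(\<Sum>a\<in>{0<..r}. if d dvd a then w ^ (a * n) else 0) = (if r div d dvd n then of_nat (r div d) else 0)"
    if d: "d dvd r" for d
  proof -
    obtain q where q: "r = d * q" using d by (elim dvdE)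
    have pos: "d > 0" "q > 0" using assms q by auto
    have wd: "w ^ d = cis (2 * pi / real q)" unfolding w_def Complex.DeMoivre using pos by (simp add: q)
    have "(\<Sum>a\<in>{0<..r}. if d dvd a then w ^ (a * n) else 0) = (\<Sum>a\<in>{0<..r} \<inter> {a. d dvd a}. w ^ (a * n))"
      by (simp add: sum.inter_restrict)
    also have "\<dots> = (\<Sum>b\<in>{0<..q}. w ^ (d * b * n))"
      by (rule sum.reindex_bij_witness[of _ "\<lambda>b. d * b" "\<lambda>a. a div d"]) (use pos in \<open>auto simp: q\<close>)
    also have "\<dots> = (\<Sum>b\<in>{0<..q}. cis (2 * pi / real q) ^ (b * n))"
      by (simp add: mult.assoc power_mult[of w d] wd)
    also have "\<dots> = (if q dvd n then of_nat q else 0)" using pos by (simp add: sum_root_of_unity_powers)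
    finally show ?thesis using pos by (simp add: q)
  qed
  have "totatives r = {0<..r} \<inter> {a. coprime a r}" by (auto simp: totatives_def)
  then have "ramanujan_sum r n = (\<Sum>a\<in>{0<..r}. (if coprime a r then 1 else 0) * w ^ (a * n))"
    by (auto simp: ramanujan_sum_def w_def sum.inter_restrict intro!: sum.cong)
  also have "\<dots> = (\<Sum>a\<in>{0<..r}. \<Sum>d | d dvd r. moebius_mu d * (if d dvd a then w ^ (a * n) else 0))"
    unfolding ind by (auto simp: sum_distrib_right intro!: sum.cong)
  also have "\<dots> = (\<Sum>d | d dvd r. moebius_mu d * (\<Sum>a\<in>{0<..r}. if d dvd a then w ^ (a * n) else 0))"
    unfolding sum_distrib_left by (rule sum.swap)
  also have "\<dots> = (\<Sum>d | d dvd r. moebius_mu d * (if r div d dvd n then of_nat (r div d) else 0))"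
    by (intro sum.cong refl) (simp add: inner)
  \<comment> \<open>Passage to the complementary divisor.\<close>
  also have "\<dots> = (\<Sum>d | d dvd r. moebius_mu (r div d) * (if d dvd n then of_nat d else 0))"
    by (rule sum.reindex_bij_witness[of _ "\<lambda>d. r div d" "\<lambda>d. r div d"])
      (use assms in \<open>auto elim!: dvdE\<close>)
  finally show ?thesis .
qed

section \<open>Rounding errors and the correlation of two Ramanujan sums\<close>

lemma sum_indicator_multiples:
  assumes "m > 0"
  shows "(\<Sum>n=1..N. if m dvd n then 1 else 0 :: complex) = of_nat (N div m)"
proof -
  have "(\<Sum>n=1..N. if m dvd n then 1 else 0 :: complex) = (\<Sum>n\<in>{1..N} \<inter> {n. m dvd n}. 1)"
    by (simp only: sum.inter_restrict finite_atLeastAtMost mem_Collect_eq)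
  also have "\<dots> = (\<Sum>k\<in>{1..N div m}. 1)"
    by (rule sum.reindex_bij_witness[of _ "\<lambda>k. m * k" "\<lambda>n. n div m"])
      (use assms in \<open>auto simp: Suc_le_eq div_le_mono less_eq_div_iff_mult_less_eq mult.commute elim!: dvdE\<close>)
  finally show ?thesis by simp
qed

lemma abs_div_minus_divide_le_powr:
  fixes N m :: nat and t :: real
  assumes "m > 0" and "0 \<le> t" and "t \<le> 1"
  shows "\<bar>real (N div m) - real N / real m\<bar> \<le> (real N / real m) powr t"
proof -
  define x where "x = real N / real m"
  have x0: "x \<ge> 0" by (simp add: x_def)
  have fl: "real (N div m) = of_int \<lfloor>x\<rfloor>" by (simp add: x_def floor_divide_of_nat_eq)
  have "\<bar>of_int \<lfloor>x\<rfloor> - x\<bar> \<le> x powr t"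
  proof (cases "x \<ge> 1")
    case True
    then have "1 \<le> x powr t" using assms(2) by (rule ge_one_powr_ge_zero)
    then show ?thesis by linarith
  next
    case False
    then have "\<lfloor>x\<rfloor> = 0" using x0 by (simp add: floor_eq_iff)
    moreover have "x \<le> x powr t"
    \<comment> \<open>At \<open>x = 0\<close> both sides are 0, since \<open>0 powr t = 0\<close>
      for every \<open>t\<close>, including \<open>t = 0\<close>.\<close>
    proof (cases "x = 0")
      case False
      then have "x powr 1 \<le> x powr t" using x0 \<open>\<not> x \<ge> 1\<close> assms(3) by (intro powr_mono') auto
      then show ?thesis using False x0 by simp
    qed simp
    ultimately show ?thesis using x0 by simp
  qed
  then show ?thesis by (simp add: fl x_def)
qed

text \<open>Replacing the lcm by its lower bound, the geometric mean of \<open>d\<close> and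
  \<open>e\<close>, splits the bound into a factor in \<open>d\<close> and a factor in
  \<open>e\<close>, so that the later sums over \<open>r\<close> and \<open>s\<close>
  decouple.\<close>

lemma mult_divide_lcm_powr_le:
  fixes d e N :: nat and t :: real
  assumes "d > 0" and "e > 0" and "0 \<le> t"
  shows "real d * real e * (real N / real (lcm d e)) powr t
    \<le> real N powr t * (real d powr (1 - t / 2) * real e powr (1 - t / 2))"
proof -
  have "d \<le> lcm d e" "e \<le> lcm d e" using assms by (auto intro!: dvd_imp_le lcm_pos_nat)
  then have "real d * real e \<le> real (lcm d e) ^ 2"
    by (simp add: power2_eq_square mult_mono)
  then have le: "sqrt (real d * real e) \<le> real (lcm d e)" by (simp add: real_le_lsqrt)
  have pos: "sqrt (real d * real e) > 0" using assms by simp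
  have "(real N / real (lcm d e)) powr t \<le> (real N / sqrt (real d * real e)) powr t"
    using assms le pos by (intro powr_mono2 divide_left_mono mult_pos_pos) (auto simp: lcm_pos_nat)
  also have "\<dots> = real N powr t * (real d powr (- t / 2) * real e powr (- t / 2))"
    using assms by (simp add: powr_divide powr_mult powr_powr powr_minus_divide flip: powr_half_sqrt)
  finally have "real d * real e * (real N / real (lcm d e)) powr t
      \<le> real d * real e * (real N powr t * (real d powr (- t / 2) * real e powr (- t / 2)))"
    by (intro mult_left_mono) auto
  also have "\<dots> = real N powr t * ((real d powr 1 * real d powr (- t / 2)) * (real e powr 1 * real e powr (- t / 2)))"
    using assms by simp
  also have "\<dots> = real N powr t * (real d powr (1 - t / 2) * real e powr (1 - t / 2))"
    by (simp only: powr_add[symmetric]) simp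
  finally show ?thesis .
qed

text \<open>The conditions \<open>d dvd n\<close> and \<open>e dvd n\<close> merge into
  \<open>lcm d e dvd n\<close>, so the sum over \<open>n\<close> becomes a count of multiples. Its
  smooth part is exactly the expected value, and only the rounding errors remain to be
  estimated.\<close>

lemma norm_ramanujan_sum_correlation_le:
  fixes r s N :: nat and t :: real
  assumes "r > 0" and "s > 0" and "0 \<le> t" and "t \<le> 1"
  shows "norm ((\<Sum>n=1..N. ramanujan_sum r n * ramanujan_sum s n)
      - of_nat N * (if r = s then of_nat (totient r) else 0))
    \<le> real N powr t * (\<Sum>d | d dvd r. real d powr (1 - t / 2)) * (\<Sum>e | e dvd s. real e powr (1 - t / 2))"
proof -
  define w where "w d e = moebius_mu (r div d) * moebius_mu (s div e)" for d e
  have dpos: "d > 0" "e > 0" if "d dvd r" "e dvd s" for d e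
    using that assms by (auto intro!: Nat.gr0I)
  have "(\<Sum>n=1..N. ramanujan_sum r n * ramanujan_sum s n)
      = (\<Sum>n=1..N. \<Sum>d | d dvd r. \<Sum>e | e dvd s.
          w d e * of_nat (d * e) * (if lcm d e dvd n then 1 else 0))"
    unfolding ramanujan_sum_eq_sum_divisors[OF assms(1)] ramanujan_sum_eq_sum_divisors[OF assms(2)]
      sum_product w_def by (intro sum.cong refl) auto
  also have "\<dots> = (\<Sum>d | d dvd r. \<Sum>n=1..N. \<Sum>e | e dvd s.
          w d e * of_nat (d * e) * (if lcm d e dvd n then 1 else 0))"
    by (rule sum.swap)
  also have "\<dots> = (\<Sum>d | d dvd r. \<Sum>e | e dvd s. \<Sum>n=1..N.
          w d e * of_nat (d * e) * (if lcm d e dvd n then 1 else 0))"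
    by (intro sum.cong refl sum.swap)
  also have "\<dots> = (\<Sum>d | d dvd r. \<Sum>e | e dvd s. w d e * of_nat (d * e) * of_nat (N div lcm d e))"
  proof (intro sum.cong refl)
    fix d e assume "d \<in> {d. d dvd r}" "e \<in> {e. e dvd s}"
    then have "lcm d e > 0" using dpos by (auto intro!: lcm_pos_nat)
    then show "(\<Sum>n=1..N. w d e * of_nat (d * e) * (if lcm d e dvd n then 1 else 0))
        = w d e * of_nat (d * e) * of_nat (N div lcm d e)"
      by (simp only: sum_distrib_left[symmetric] sum_indicator_multiples)
  qed
  finally have main: "(\<Sum>n=1..N. ramanujan_sum r n * ramanujan_sum s n)
      = (\<Sum>d | d dvd r. \<Sum>e | e dvd s. w d e * of_nat (d * e) * of_nat (N div lcm d e))" .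
  have "of_nat N * (if r = s then of_nat (totient r) else 0)
      = (\<Sum>d | d dvd r. \<Sum>e | e dvd s. w d e * of_nat (d * e) * (of_nat N / of_nat (lcm d e)))"
  proof -
    \<comment> \<open>Since \<open>d * e / lcm d e = gcd d e\<close>, the smooth part is
      \<open>N\<close> times the orthogonality sum.\<close>
    have gcd_eq: "of_nat (d * e) * (of_nat N / of_nat (lcm d e)) = (of_nat N * of_nat (gcd d e) :: complex)"
      if "d dvd r" "e dvd s" for d e
    proof -
      have eq: "of_nat (d * e) = (of_nat (gcd d e) * of_nat (lcm d e) :: complex)"
        by (metis of_nat_mult prod_gcd_lcm_nat)
      show ?thesis unfolding eq using dpos[OF that] by simp
    qed
    show ?thesis
      unfolding sum_moebius_mu_gcd[OF assms(1,2), symmetric] sum_distrib_left w_def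
      by (intro sum.cong refl) (simp only: mem_Collect_eq mult.assoc gcd_eq, simp only: mult_ac)
  qed
  then have diff: "(\<Sum>n=1..N. ramanujan_sum r n * ramanujan_sum s n)
      - of_nat N * (if r = s then of_nat (totient r) else 0)
    = (\<Sum>d | d dvd r. \<Sum>e | e dvd s. w d e * of_nat (d * e) * 
         (of_nat (N div lcm d e) - of_nat N / of_nat (lcm d e)))"
    by (simp only: main sum_subtractf right_diff_distrib)
  have "norm ((\<Sum>n=1..N. ramanujan_sum r n * ramanujan_sum s n)
      - of_nat N * (if r = s then of_nat (totient r) else 0))
    \<le> (\<Sum>d | d dvd r. \<Sum>e | e dvd s.
      real N powr t * (real d powr (1 - t / 2) * real e powr (1 - t / 2)))"
    unfolding diff
  proof (intro sum_norm_le)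
    fix d e assume "d \<in> {d. d dvd r}" "e \<in> {e. e dvd s}"
    then have pos: "d > 0" "e > 0" using dpos by auto
    have "norm (w d e) \<le> 1"
      unfolding w_def norm_mult by (intro mult_le_one norm_moebius_mu_le norm_ge_zero)
    moreover have "norm (of_nat (N div lcm d e) - of_nat N / of_nat (lcm d e) :: complex)
        = \<bar>real (N div lcm d e) - real N / real (lcm d e)\<bar>"
    proof -
      have "(of_nat (N div lcm d e) - of_nat N / of_nat (lcm d e) :: complex)
        = of_real (real (N div lcm d e) - real N / real (lcm d e))" by simp
      then show ?thesis by (simp only: norm_of_real)
    qed
    moreover have "\<dots> \<le> (real N / real (lcm d e)) powr t"
      using pos assms by (intro abs_div_minus_divide_le_powr lcm_pos_nat)
    ultimately have "norm (w d e * of_nat (d * e) * 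
         (of_nat (N div lcm d e) - of_nat N / of_nat (lcm d e)))
        \<le> 1 * real (d * e) * (real N / real (lcm d e)) powr t"
      unfolding norm_mult norm_of_nat by (intro mult_mono) auto
    also have "\<dots> \<le> real N powr t * (real d powr (1 - t / 2) * real e powr (1 - t / 2))"
      using mult_divide_lcm_powr_le[OF pos assms(3)] by simp
    finally show "norm (w d e * of_nat (d * e) * 
         (of_nat (N div lcm d e) - of_nat N / of_nat (lcm d e)))
        \<le> real N powr t * (real d powr (1 - t / 2) * real e powr (1 - t / 2))" .
  qed
  also have "\<dots> = real N powr t * (\<Sum>d | d dvd r. real d powr (1 - t / 2)) * (\<Sum>e | e dvd s. real e powr (1 - t / 2))"
    by (simp only: sum_distrib_left[symmetric] sum_distrib_right[symmetric] mult.assoc)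
  finally show ?thesis .
qed

section \<open>Convergence of series weighted by divisor sums\<close>

lemma summable_on_powr_atLeast_1:
  assumes "a < -1"
  shows "(\<lambda>n. real n powr a) summable_on {1..}"
proof -
  have "(\<lambda>n. real n powr a) summable_on UNIV"
    using assms by (intro norm_summable_imp_summable_on) (simp add: summable_real_powr_iff)
  then show ?thesis by (rule summable_on_subset) auto
qed

text \<open>Writing \<open>r = d * k\<close> turns the double series into the product of the
  convergent series of \<open>d powr (a + b)\<close> and \<open>k powr a\<close>.\<close>

lemma summable_on_powr_times_divisor_sum:
  fixes a b :: real
  assumes "a < -1" and "a + b < -1"
  shows "(\<lambda>r. real r powr a * (\<Sum>d | d dvd r. real d powr b)) summable_on {1..}"
proof -
  have "(\<lambda>(d, k). real d powr (a + b) * real k powr a) summable_on {1..} \<times> {1..}"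
  proof (rule summable_on_SigmaI)
    fix d :: nat
    show "((\<lambda>k. case (d, k) of (d, k) \<Rightarrow> real d powr (a + b) * real k powr a) has_sum
       real d powr (a + b) * (\<Sum>\<^sub>\<infinity>k\<in>{1..}. real k powr a)) {1..}"
      unfolding prod.case using summable_on_powr_atLeast_1[OF assms(1)] 
      by (intro has_sum_cmult_right has_sum_infsum)
    show "(\<lambda>d. real d powr (a + b) * (\<Sum>\<^sub>\<infinity>k\<in>{1..}. real k powr a)) summable_on {1..}"
      using summable_on_powr_atLeast_1[OF assms(2)] by (rule summable_on_cmult_left)
  qed auto
  also have "?this \<longleftrightarrow> (\<lambda>(r, d). real r powr a * real d powr b) summable_on (SIGMA r:{1..}. {d. d dvd r})"
    by (rule summable_on_reindex_bij_witness[of _ "\<lambda>(r, d). (d, r div d)" "\<lambda>(d, k). (d * k, d)"])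
      (auto simp: powr_add powr_mult Suc_le_eq dvd_div_eq_0_iff elim!: dvdE intro!: Nat.gr0I)
  finally have "(\<lambda>r. \<Sum>\<^sub>\<infinity>d\<in>{d. d dvd r}. real r powr a * real d powr b) summable_on {1..}"
    by (intro summable_on_SigmaD[where f = "\<lambda>(r, d). real r powr a * real d powr b", unfolded prod.case])
      (auto intro!: summable_on_finite)
  also have "?this \<longleftrightarrow> (\<lambda>r. real r powr a * (\<Sum>d | d dvd r. real d powr b)) summable_on {1..}"
    by (intro summable_on_cong) (simp add: sum_distrib_left)
  finally show ?thesis .
qed

lemma has_sum_finite_sum:
  fixes f :: "'i \<Rightarrow> 'a \<Rightarrow> 'b :: topological_comm_monoid_add"
  assumes "finite I" and "\<And>i. i \<in> I \<Longrightarrow> (f i has_sum S i) A"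
  shows "((\<lambda>x. \<Sum>i\<in>I. f i x) has_sum (\<Sum>i\<in>I. S i)) A"
  using assms by (induction I rule: finite_induct) (auto intro!: has_sum_add)

lemma has_sum_diff:
  fixes f g :: "'a \<Rightarrow> 'b :: topological_ab_group_add"
  assumes "(f has_sum S) A" and "(g has_sum T) A"
  shows "((\<lambda>x. f x - g x) has_sum (S - T)) A"
  using has_sum_add[OF assms(1), of "\<lambda>x. - g x" "- T"] assms(2) by (simp add: has_sum_uminus)

section \<open>Summation of the errors over both expansions\<close>

theorem theorem1p1:
  fixes f g fhat ghat :: "nat \<Rightarrow> complex" and \<delta> :: real
  assumes "abs_conv_ramanujan_expansion f fhat"
    and "abs_conv_ramanujan_expansion g ghat"
    and "\<delta> > 1 / 2"
    and "\<exists>C. \<forall>r\<ge>1. norm (fhat r) \<le> C * real r powr (- (1 + \<delta>))"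
    and "\<exists>C. \<forall>r\<ge>1. norm (ghat r) \<le> C * real r powr (- (1 + \<delta>))"
  shows "(\<lambda>r. fhat r * ghat r * of_nat (totient r)) summable_on {1..} \<and>
    (\<lambda>N::nat. (\<Sum>n=1..N. f n * g n)
        - of_nat N * (\<Sum>\<^sub>\<infinity>r\<in>{1..}. fhat r * ghat r * of_nat (totient r)))
      \<in> O[at_top](\<lambda>N. complex_of_real
            (real N powr (2 / (1 + 2 * \<delta>)) * ln (real N) powr ((5 + 2 * \<delta>) / (1 + 2 * \<delta>))))"
proof
  define t where "t = 2 / (1 + 2 * \<delta>)"
  have t01: "0 \<le> t" "t \<le> 1" using assms(3) by (auto simp: t_def)
  \<comment> \<open>A rearrangement of \<open>\<delta> + t / 2 > 1\<close>, which is the second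
    inequality in \<open>exps\<close>.\<close>
  have "2 - 2 * \<delta> < t"
  proof -
    have "(2 - 2 * \<delta>) * (1 + 2 * \<delta>) = 2 - 4 * \<delta> * (\<delta> - 1 / 2)" by (simp add: algebra_simps)
    also have "\<dots> < 2" using assms(3) by (simp add: mult_pos_pos)
    finally show ?thesis using assms(3) by (simp add: t_def pos_less_divide_eq)
  qed
  then have exps: "- (1 + \<delta>) < -1" "- (1 + \<delta>) + (1 - t / 2) < -1" using assms(3) by auto
  define S where "S r = (\<Sum>d | d dvd r. real d powr (1 - t / 2))" for r :: nat
  have S_nonneg: "S r \<ge> 0" for r by (simp add: S_def sum_nonneg)
  have fs: "((\<lambda>r. fhat r * ramanujan_sum r n) has_sum f n) {1..}"
    and gs: "((\<lambda>r. ghat r * ramanujan_sum r n) has_sum g n) {1..}" if "n \<ge> 1" for n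
    using assms(1,2) that by (auto simp: abs_conv_ramanujan_expansion_def)
  obtain C1 where C1: "norm (fhat r) \<le> C1 * real r powr (- (1 + \<delta>))" if "r \<ge> 1" for r
    using assms(4) by blast
  obtain C2 where C2: "norm (ghat r) \<le> C2 * real r powr (- (1 + \<delta>))" if "r \<ge> 1" for r
    using assms(5) by blast
  have weighted: "(\<lambda>r. norm (h r) * S r) summable_on {1..}"
    if h: "\<And>r. r \<ge> 1 \<Longrightarrow> norm (h r) \<le> C * real r powr (- (1 + \<delta>))" for h :: "nat \<Rightarrow> complex" and C
  proof (rule summable_on_comparison_test)
    show "(\<lambda>r. C * (real r powr (- (1 + \<delta>)) * S r)) summable_on {1..}"
      unfolding S_def by (intro summable_on_cmult_right summable_on_powr_times_divisor_sum exps)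
    show "norm (h r) * S r \<le> C * (real r powr (- (1 + \<delta>)) * S r)" if "r \<in> {1..}" for r
      using mult_right_mono[OF h S_nonneg, of r r] that by (simp add: mult.assoc)
  qed (simp add: S_nonneg)
  define F where "F = (\<Sum>\<^sub>\<infinity>r\<in>{1..}. norm (fhat r) * S r)"
  define G where "G = (\<Sum>\<^sub>\<infinity>r\<in>{1..}. norm (ghat r) * S r)"
  have F: "((\<lambda>r. norm (fhat r) * S r) has_sum F) {1..}"
    unfolding F_def using weighted[OF C1] by (rule has_sum_infsum)
  have G: "((\<lambda>r. norm (ghat r) * S r) has_sum G) {1..}"
    unfolding G_def using weighted[OF C2] by (rule has_sum_infsum)
  define M where "M = (\<Sum>\<^sub>\<infinity>r\<in>{1..}. fhat r * ghat r * of_nat (totient r))"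
  show summ: "(\<lambda>r. fhat r * ghat r * of_nat (totient r)) summable_on {1..}"
  proof (rule abs_summable_summable, rule Infinite_Sum.abs_summable_on_comparison_test')
    \<comment> \<open>Two coefficient bounds and \<open>totient r \<le> r\<close> give the exponent
      \<open>-1 - 2 * \<delta>\<close>.\<close>
    show "(\<lambda>r. C1 * C2 * real r powr (- 2 * (1 + \<delta>) + 1)) summable_on {1..}"
      using assms(3) by (intro summable_on_cmult_right summable_on_powr_atLeast_1) simp
    fix r :: nat assume "r \<in> {1..}"
    then have r: "r \<ge> 1" by simp
    have "norm (fhat r * ghat r * of_nat (totient r))
        \<le> (C1 * real r powr (- (1 + \<delta>))) * (C2 * real r powr (- (1 + \<delta>))) * real r powr 1"
      unfolding norm_mult norm_of_nat
      \<comment> \<open>The coefficient bounds at \<open>r = 1\<close> show that \<open>C1\<close>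
        and \<open>C2\<close> are nonnegative.\<close>
      using order_trans[OF norm_ge_zero C1[of 1]] order_trans[OF norm_ge_zero C2[of 1]] r
      by (intro mult_mono C1 C2 mult_nonneg_nonneg) (auto simp: totient_le)
    also have "\<dots> = C1 * C2 * (real r powr (- (1 + \<delta>)) * real r powr (- (1 + \<delta>)) * real r powr 1)"
      by (simp only: mult_ac)
    also have "\<dots> = C1 * C2 * real r powr (- 2 * (1 + \<delta>) + 1)"
      by (simp only: powr_add[symmetric]) (simp add: algebra_simps)
    finally show "norm (fhat r * ghat r * of_nat (totient r)) \<le> C1 * C2 * real r powr (- 2 * (1 + \<delta>) + 1)" .
  qed
  define E where "E N r s = (\<Sum>n=1..N. ramanujan_sum r n * ramanujan_sum s n)
      - of_nat N * (if r = s then of_nat (totient r) else 0)" for N r s :: nat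
  have E_le: "norm (E N r s) \<le> real N powr t * S r * S s" if "r \<ge> 1" "s \<ge> 1" for N r s
    unfolding E_def S_def using that t01 by (intro norm_ramanujan_sum_correlation_le) auto
  have bound: "norm ((\<Sum>n=1..N. f n * g n) - of_nat N * M) \<le> F * (real N powr t * G)" for N
  proof -
    \<comment> \<open>The error with \<open>r\<close> fixed and only \<open>g\<close> expanded.
      Summing first over \<open>s\<close> and then over \<open>r\<close> keeps every sum a single
      series, with no rearrangement of a double series.\<close>
    define H where "H r = (\<Sum>n=1..N. ramanujan_sum r n * g n) - of_nat N * (ghat r * of_nat (totient r))" for r
    have H_le: "norm (H r) \<le> real N powr t * S r * G" if r: "r \<ge> 1" for r
    proof (rule norm_infsum_le)
      \<comment> \<open>The expected value is written as a series in \<open>s\<close> whose only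
        possibly nonzero term is at \<open>s = r\<close>, so that it can be subtracted
        termwise.\<close>
      have "((\<lambda>s. (\<Sum>n=1..N. ramanujan_sum r n * (ghat s * ramanujan_sum s n))
          - of_nat N * (if s = r then ghat r * of_nat (totient r) else 0)) has_sum H r) {1..}"
        unfolding H_def
        by (intro has_sum_diff has_sum_finite_sum has_sum_cmult_right gs
              has_sum_finite_neutralI[of "{r}"]) (use r in auto)
      also have "(\<lambda>s. (\<Sum>n=1..N. ramanujan_sum r n * (ghat s * ramanujan_sum s n))
          - of_nat N * (if s = r then ghat r * of_nat (totient r) else 0)) = (\<lambda>s. ghat s * E N r s)"
        by (auto simp: E_def fun_eq_iff sum_distrib_left right_diff_distrib mult_ac)
      finally show "((\<lambda>s. ghat s * E N r s) has_sum H r) {1..}" .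
      show "((\<lambda>s. real N powr t * S r * (norm (ghat s) * S s)) has_sum real N powr t * S r * G) {1..}"
        using G by (rule has_sum_cmult_right)
      show "norm (ghat s * E N r s) \<le> real N powr t * S r * (norm (ghat s) * S s)" if "s \<in> {1..}" for s
        using mult_left_mono[OF E_le[OF r, of s N] norm_ge_zero[of "ghat s"]] that
        by (simp add: norm_mult mult_ac)
    qed
    show ?thesis
    proof (rule norm_infsum_le)
      have "((\<lambda>r. (\<Sum>n=1..N. (fhat r * ramanujan_sum r n) * g n)
          - of_nat N * (fhat r * ghat r * of_nat (totient r))) has_sum (\<Sum>n=1..N. f n * g n) - of_nat N * M) {1..}"
        unfolding M_def using summ
        by (intro has_sum_diff has_sum_finite_sum has_sum_cmult_right has_sum_cmult_left fs
              has_sum_infsum) auto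
      also have "(\<lambda>r. (\<Sum>n=1..N. (fhat r * ramanujan_sum r n) * g n)
          - of_nat N * (fhat r * ghat r * of_nat (totient r))) = (\<lambda>r. fhat r * H r)"
        by (auto simp: H_def fun_eq_iff sum_distrib_left right_diff_distrib mult_ac)
      finally show "((\<lambda>r. fhat r * H r) has_sum (\<Sum>n=1..N. f n * g n) - of_nat N * M) {1..}" .
      show "((\<lambda>r. norm (fhat r) * S r * (real N powr t * G)) has_sum F * (real N powr t * G)) {1..}"
        using F by (rule has_sum_cmult_left)
      show "norm (fhat r * H r) \<le> norm (fhat r) * S r * (real N powr t * G)" if "r \<in> {1..}" for r
        using mult_left_mono[OF H_le[of r] norm_ge_zero[of "fhat r"]] that
        by (simp add: norm_mult mult_ac)
    qed
  qed
  have FG: "F * G \<ge> 0"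
    using has_sum_nonneg[OF F] has_sum_nonneg[OF G] by (simp add: S_nonneg)
  show "(\<lambda>N::nat. (\<Sum>n=1..N. f n * g n)
        - of_nat N * (\<Sum>\<^sub>\<infinity>r\<in>{1..}. fhat r * ghat r * of_nat (totient r)))
      \<in> O[at_top](\<lambda>N. complex_of_real
            (real N powr (2 / (1 + 2 * \<delta>)) * ln (real N) powr ((5 + 2 * \<delta>) / (1 + 2 * \<delta>))))"
    unfolding M_def[symmetric] t_def[symmetric]
  \<comment> \<open>From \<open>N = 3\<close> on, \<open>ln N \<ge> 1\<close> because
    \<open>exp 1 \<le> 3\<close>, so the logarithmic factor only enlarges the bound already
    proved.\<close>
  proof (rule bigoI[of _ "F * G"], rule eventually_mono[OF eventually_ge_at_top[of 3]])
    fix N :: nat assume "N \<ge> 3"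
    then have "1 \<le> ln (real N)"
      using exp_le by (subst ln_ge_iff) (auto intro: order_trans)
    then have "1 \<le> ln (real N) powr ((5 + 2 * \<delta>) / (1 + 2 * \<delta>))"
      using assms(3) by (intro ge_one_powr_ge_zero) auto
    then have "F * G * (real N powr t * 1)
        \<le> F * G * (real N powr t * ln (real N) powr ((5 + 2 * \<delta>) / (1 + 2 * \<delta>)))"
      by (intro mult_left_mono FG) auto
    moreover have "norm (complex_of_real (real N powr t * ln (real N) powr ((5 + 2 * \<delta>) / (1 + 2 * \<delta>))))
        = real N powr t * ln (real N) powr ((5 + 2 * \<delta>) / (1 + 2 * \<delta>))"
      by (simp add: norm_mult)
    ultimately show "norm ((\<Sum>n=1..N. f n * g n) - of_nat N * M) \<le> F * G * norm (complex_of_real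
            (real N powr t * ln (real N) powr ((5 + 2 * \<delta>) / (1 + 2 * \<delta>))))"
      using bound[of N] by (simp add: mult_ac)
  qed
qed

end
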